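(* Let $n\ge 1$, $\alpha\in\mathbb{R}$ with $|\alpha|<\pi/2$, and let $\boldsymbol{\theta}=(\theta_1,\dots,\theta_n)\in\mathbb{R}^n$. Let $D$ be the diagonal matrix with $D_{ii}=-\sum_{j=1}^n\cos(\theta_j-\theta_i-\alpha)$, let $A=[\cos(\theta_j-\theta_i-\alpha)]_{i,j=1}^n$, and assume $D$ is non-singular. Let $n_+(D)$ be the number of positive eigenvalues of $D$, let $n_R$ be the number of roots of the polynomial $P_{\mathbf{J}}(s)$ (defined in the context) in the open interval $(0,1)$, and let $n_+(D+A)$ be the number of eigenvalues of $D+A$ in the open right half-plane $\mathrm{Re}(\lambda)>0$, counted with algebraic multiplicity. Assume that $s=1$ is a simple root of $\det(D+sA)$, and let $\lambda_0(s)$ be the (real, differentiable) branch of eigenvalues of $D+sA$, defined for $s$ near $1$, with $\lambda_0(1)=0$. Then $$(-1)^{n_+(D+A)-n_+(D)-n_R}=\operatorname{sign}\left(\left.\frac{d\lambda_0}{ds}\right|_{s=1}\right).$$ In particular, each of the following is a sufficient condition for instability (that is, for $n_+(D+A)\ge 1$), where $\frac{d\lambda_0}{ds}$ is evaluated at $s=1$: (i) $n_R=0$, $n_+(D)$ even and $\frac{d\lambda_0}{ds}<0$; (ii) $n_R=0$, $n_+(D)$ odd and $\frac{d\lambda_0}{ds}>0$; (iii) $n_R=1$, $n_+(D)$ even and $\frac{d\lambda_0}{ds}>0$; (iv) $n_R=1$, $n_+(D)$ odd and $\frac{d\lambda_0}{ds}<0$.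
   Context: The matrix $D+A$ is the Jacobian, at the configuration $\boldsymbol{\theta}$, of the Kuramoto--Sakaguchi vector field $f_i(\boldsymbol{\theta},\alpha)=\sum_{j=1}^n(\sin(\theta_j-\theta_i-\alpha)+\sin\alpha)$; its row sums are all zero, so $0$ is always an eigenvalue of $D+A$. Define vectors in $\mathbb{R}^n$ by $u_i=\cos(\theta_i+\alpha/2)$, $v_i=\cos(\theta_i-\alpha/2)$, $w_i=\sin(\theta_i+\alpha/2)$, $z_i=\sin(\theta_i-\alpha/2)$, so that $A=uv^t+wz^t$. When $D$ is non-singular, define the polynomial (of degree at most two) $$P_{\mathbf{J}}(s)=1+\big(\langle v,D^{-1}u\rangle+\langle z,D^{-1}w\rangle\big)s+\big(\langle v,D^{-1}u\rangle\langle z,D^{-1}w\rangle-\langle z,D^{-1}u\rangle\langle v,D^{-1}w\rangle\big)s^2 .$$ It satisfies $\det(D+sA)=\det(D)\,P_{\mathbf{J}}(s)$. *)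

theory Defs
  imports Complex_Main "Jordan_Normal_Form.Spectral_Radius"
begin

text \<open>
  Vectors and matrices are those of Jordan_Normal_Form, with indices \<open>0..<n\<close> and
  \<open>n = dim_vec \<theta>\<close>. The arguments are always the configuration \<open>\<theta>\<close> and the phase lag \<open>\<alpha>\<close>.
\<close>

definition ks_D :: "real vec \<Rightarrow> real \<Rightarrow> real mat" where
  "ks_D \<theta> \<alpha> = mat_diag (dim_vec \<theta>) (\<lambda>i. - (\<Sum>j<dim_vec \<theta>. cos (\<theta> $ j - \<theta> $ i - \<alpha>)))"

definition ks_A :: "real vec \<Rightarrow> real \<Rightarrow> real mat" where
  "ks_A \<theta> \<alpha> = mat (dim_vec \<theta>) (dim_vec \<theta>) (\<lambda>(i, j). cos (\<theta> $ j - \<theta> $ i - \<alpha>))"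

definition ks_u :: "real vec \<Rightarrow> real \<Rightarrow> real vec" where
  "ks_u \<theta> \<alpha> = vec (dim_vec \<theta>) (\<lambda>i. cos (\<theta> $ i + \<alpha> / 2))"

definition ks_v :: "real vec \<Rightarrow> real \<Rightarrow> real vec" where
  "ks_v \<theta> \<alpha> = vec (dim_vec \<theta>) (\<lambda>i. cos (\<theta> $ i - \<alpha> / 2))"

definition ks_w :: "real vec \<Rightarrow> real \<Rightarrow> real vec" where
  "ks_w \<theta> \<alpha> = vec (dim_vec \<theta>) (\<lambda>i. sin (\<theta> $ i + \<alpha> / 2))"

definition ks_z :: "real vec \<Rightarrow> real \<Rightarrow> real vec" where
  "ks_z \<theta> \<alpha> = vec (dim_vec \<theta>) (\<lambda>i. sin (\<theta> $ i - \<alpha> / 2))"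

text \<open>\<open>mat_inverse\<close> returns an option; its value is \<open>Some\<close> exactly when \<open>D\<close> is non-singular,
  and \<open>P\<^sub>J\<close> is only meaningful in that case.\<close>

definition ks_P :: "real vec \<Rightarrow> real \<Rightarrow> real poly" where
  "ks_P \<theta> \<alpha> =
    (let D' = the (mat_inverse (ks_D \<theta> \<alpha>));
         u = ks_u \<theta> \<alpha>; v = ks_v \<theta> \<alpha>; w = ks_w \<theta> \<alpha>; z = ks_z \<theta> \<alpha>
     in [: 1,
           v \<bullet> (D' *\<^sub>v u) + z \<bullet> (D' *\<^sub>v w),
           (v \<bullet> (D' *\<^sub>v u)) * (z \<bullet> (D' *\<^sub>v w)) - (z \<bullet> (D' *\<^sub>v u)) * (v \<bullet> (D' *\<^sub>v w)) :])"

text \<open>\<open>det (D + s A)\<close> as a polynomial in the indeterminate \<open>s\<close>.\<close>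

definition ks_pencil_det :: "real vec \<Rightarrow> real \<Rightarrow> real poly" where
  "ks_pencil_det \<theta> \<alpha> =
    det (map_mat (\<lambda>c. [:c:]) (ks_D \<theta> \<alpha>) + [:0, 1:] \<cdot>\<^sub>m map_mat (\<lambda>c. [:c:]) (ks_A \<theta> \<alpha>))"

text \<open>Both counts below are with algebraic multiplicity, i.e. the multiplicity as a root of the
  characteristic polynomial. The first one counts real eigenvalues, the second one complex
  eigenvalues.\<close>

definition num_pos_eigenvalues :: "real mat \<Rightarrow> nat" where
  "num_pos_eigenvalues M =
    (\<Sum>x \<in> {x. eigenvalue M x \<and> x > 0}. order x (char_poly M))"

definition num_rhp_eigenvalues :: "real mat \<Rightarrow> nat" where
  "num_rhp_eigenvalues M =
    (let MC = map_mat complex_of_real M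
     in \<Sum>x \<in> {x. eigenvalue MC x \<and> Re x > 0}. order x (char_poly MC))"

end

theory Submission
  imports Defs
begin

text \<open>
  Let \<open>\<chi>(x, s)\<close> be the characteristic polynomial of \<open>D + s A\<close>. Differentiating
  \<open>\<chi>(\<lambda>\<^sub>0(s), s) = 0\<close> at \<open>s = 1\<close> gives \<open>\<chi>\<^sub>x(0, 1) \<lambda>\<^sub>0' = - \<chi>\<^sub>s(0, 1)\<close>, where
  \<open>\<chi>(0, s) = (-1)\<^sup>n det (D + s A)\<close> has a simple root at \<open>1\<close>. Hence both factors on the left are
  nonzero; in particular \<open>0\<close> is a simple eigenvalue of \<open>D + A\<close>, although this is not assumed.
  The sign of \<open>\<chi>\<^sub>x(0, 1)\<close>, the value at \<open>0\<close> of the monic polynomial \<open>\<chi>(x, 1) / x\<close>, is the parity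
  of its number of positive roots, which is that of \<open>n\<^sub>+(D + A)\<close> because non-real eigenvalues come
  in conjugate pairs. The sign of \<open>\<chi>\<^sub>s(0, 1)\<close> follows from \<open>det (D + s A) = det D * P(s)\<close> and the
  sign of \<open>P'(1)\<close>, which is determined by whether the other root of \<open>P\<close> lies in \<open>(0, 1)\<close>.
\<close>

subsection \<open>Sign at zero and number of positive roots\<close>

text \<open>Induction on the degree. Dividing by \<open>x - a\<close> with \<open>a > 0\<close>
  flips the sign at 0 and lowers the count by one. Without positive roots the sign at 0 is that near
  infinity, by the intermediate value theorem.\<close>

lemma sgn_poly_0_pos_roots:
  fixes q :: "real poly"
  assumes "lead_coeff q > 0" "poly q 0 \<noteq> 0"
  shows "sgn (poly q 0) = (-1) ^ (\<Sum>x | poly q x = 0 \<and> x > 0. order x q)"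
  using assms
proof (induction "degree q" arbitrary: q rule: less_induct)
  case less
  have q0: "q \<noteq> 0" using less.prems by auto
  show ?case
  proof (cases "\<exists>x>0. poly q x = 0")
    case False
    have "poly q 0 > 0"
    proof (rule ccontr)
      assume "\<not> poly q 0 > 0"
      hence neg: "poly q 0 < 0" using less.prems by simp
      from poly_pinfty_gt_lc[OF less.prems(1)]
      obtain k where "\<forall>x\<ge>k. poly q x \<ge> lead_coeff q" by blast
      hence "poly q (max k 1) > 0"
        using less.prems(1) by (metis max.cobounded1 less_le_trans)
      moreover have "0 < max k 1" by (simp add: less_max_iff_disj)
      ultimately show False using poly_IVT_pos[of 0 "max k 1" q] neg False by blast
    qed
    moreover have no_roots: "{x. poly q x = 0 \<and> x > 0} = {}" using False by auto
    ultimately show ?thesis unfolding no_roots by simp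
  next
    case True
    then obtain a where a: "a > 0" "poly q a = 0" by blast
    then obtain r where r: "q = [:- a, 1:] * r" by (auto simp: poly_eq_0_iff_dvd)
    have r0: "r \<noteq> 0" using q0 r by auto
    have deg: "degree q = Suc (degree r)"
      unfolding r using r0 by (subst degree_mult_eq) auto
    have lead: "lead_coeff r > 0"
      using less.prems(1) by (simp only: r lead_coeff_mult) simp
    have r00: "poly r 0 \<noteq> 0" using less.prems(2) r by auto
    have IH: "sgn (poly r 0) = (-1) ^ (\<Sum>x | poly r x = 0 \<and> x > 0. order x r)"
      using less.hyps[of r] deg lead r00 by simp
    let ?R = "{x. poly q x = 0 \<and> x > 0}"
    have fin: "finite ?R" using poly_roots_finite[OF q0] by simp
    have ord: "order x q = of_bool (x = a) + order x r" for x
      unfolding r using r0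
      by (subst order_mult) (auto simp del: mult_pCons_left simp: order_linear')
    have "(\<Sum>x\<in>?R. order x q) = (\<Sum>x\<in>?R. of_bool (x = a)) + (\<Sum>x\<in>?R. order x r)"
      by (simp add: ord sum.distrib)
    also have "(\<Sum>x\<in>?R. of_bool (x = a)) = (1::nat)"
      using fin a by (simp add: of_bool_def if_distrib)
    \<comment> \<open>If \<open>a\<close> is no longer a root of \<open>r\<close>, it still lies in
      \<open>?R\<close> but contributes order 0.\<close>
    also have "(\<Sum>x\<in>?R. order x r) = (\<Sum>x | poly r x = 0 \<and> x > 0. order x r)"
      using fin by (intro sum.mono_neutral_right) (auto simp: r order_root)
    finally have "(\<Sum>x\<in>?R. order x q) = Suc (\<Sum>x | poly r x = 0 \<and> x > 0. order x r)" by simp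
    moreover have "sgn (poly q 0) = - sgn (poly r 0)"
      using a by (simp add: r sgn_mult)
    ultimately show ?thesis using IH by simp
  qed
qed

lemma order_map_poly_of_real:
  "order (complex_of_real x) (map_poly complex_of_real q) = order x q"
proof -
  interpret h: map_poly_inj_idom_divide_hom complex_of_real by unfold_locales auto
  show ?thesis by (rule h.order_hom)
qed

text \<open>Conjugation is a field automorphism that fixes the real coefficients.\<close>

lemma order_cnj_of_real_poly:
  fixes q :: "real poly"
  shows "order (cnj x) (map_poly complex_of_real q) = order x (map_poly complex_of_real q)"
proof -
  interpret h: map_poly_inj_idom_divide_hom cnj by unfold_locales auto
  have "map_poly cnj (map_poly complex_of_real q) = map_poly complex_of_real q"
    by (rule poly_eqI) (simp add: coeff_map_poly)
  with h.order_hom[of x "map_poly complex_of_real q"] show ?thesis by simp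
qed

lemma even_rhp_roots_iff:
  fixes q :: "real poly"
  assumes "q \<noteq> 0"
  defines "p \<equiv> map_poly complex_of_real q"
  shows "even (\<Sum>x | poly p x = 0 \<and> Re x > 0. order x p) \<longleftrightarrow>
         even (\<Sum>x | poly q x = 0 \<and> x > 0. order x q)"
proof -
  have p0: "p \<noteq> 0" using assms by (simp add: map_poly_eq_0_iff)
  have fin: "finite {x. poly p x = 0}" by (rule poly_roots_finite[OF p0])
  define R where "R = {x. poly p x = 0 \<and> Re x > 0 \<and> Im x = 0}"
  define U where "U = {x. poly p x = 0 \<and> Re x > 0 \<and> Im x > 0}"
  define L where "L = {x. poly p x = 0 \<and> Re x > 0 \<and> Im x < 0}"
  have split: "{x. poly p x = 0 \<and> Re x > 0} = R \<union> (U \<union> L)"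
    by (auto simp: R_def U_def L_def)
  have fins: "finite R" "finite U" "finite L"
    using fin by (auto simp: R_def U_def L_def)
  have root: "poly p x = 0 \<longleftrightarrow> order x p \<noteq> 0" for x using p0 by (simp add: order_root)
  have cnj: "order (cnj x) p = order x p" for x
    unfolding p_def by (rule order_cnj_of_real_poly)
  \<comment> \<open>Conjugation swaps \<open>U\<close> and \<open>L\<close> and keeps orders, so
    together they contribute an even number and only the real roots \<open>R\<close> decide the
    parity.\<close>
  have "(\<Sum>x\<in>U. order x p) = (\<Sum>x\<in>L. order x p)"
    by (rule sum.reindex_bij_witness[of _ cnj cnj]) (auto simp: U_def L_def root cnj)
  moreover have "(\<Sum>x\<in>R. order x p) = (\<Sum>x | poly q x = 0 \<and> x > 0. order x q)"
  proof (rule sum.reindex_bij_witness[of _ complex_of_real Re])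
    fix x assume "x \<in> R"
    hence x: "complex_of_real (Re x) = x" "poly p x = 0" "Re x > 0"
      by (auto simp: R_def complex_eq_iff)
    show "complex_of_real (Re x) = x" by (rule x)
    show ord: "order (Re x) q = order x p"
      using order_map_poly_of_real[of "Re x" q] x by (simp add: p_def)
    show "Re x \<in> {x. poly q x = 0 \<and> x > 0}"
      using x ord assms(1) root[of x] by (auto simp: order_root)
  next
    fix x assume "x \<in> {x. poly q x = 0 \<and> x > 0}"
    thus "complex_of_real x \<in> R"
      using assms(1) by (auto simp: R_def root p_def order_map_poly_of_real order_root)
  qed simp
  ultimately show ?thesis
    unfolding split by (subst sum.union_disjoint; (subst sum.union_disjoint)?)
      (use fins in \<open>auto simp: R_def U_def L_def\<close>)
qed

lemma sgn_poly_0_rhp_roots: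
  fixes q :: "real poly"
  assumes "lead_coeff q > 0" "poly q 0 \<noteq> 0"
  defines "p \<equiv> map_poly complex_of_real q"
  shows "sgn (poly q 0) = (-1) ^ (\<Sum>x | poly p x = 0 \<and> Re x > 0. order x p)"
proof -
  have "q \<noteq> 0" using assms by auto
  from sgn_poly_0_pos_roots[OF assms(1,2)] even_rhp_roots_iff[OF this] show ?thesis
    by (simp add: p_def uminus_power_if)
qed

subsection \<open>Determinant of a rank-two update\<close>

text \<open>Both \<open>M * N\<close> and \<open>N * M\<close> are block lower triangular, with one
  side of the identity each as determinant. For \<open>m = 2\<close> this reduces an
  \<open>n\<close> by \<open>n\<close> determinant to a 2 by 2 one.\<close>

lemma det_one_plus_mult_commute:
  fixes X Y :: "'a :: idom mat"
  assumes X: "X \<in> carrier_mat n m" and Y: "Y \<in> carrier_mat m n"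
  shows "det (1\<^sub>m n + X * Y) = det (1\<^sub>m m + Y * X)"
proof -
  define M where "M = four_block_mat (1\<^sub>m n) (- X) Y (1\<^sub>m m)"
  define N where "N = four_block_mat (1\<^sub>m n) X (0\<^sub>m m n) (1\<^sub>m m)"
  have MN: "M \<in> carrier_mat (n + m) (n + m)" "N \<in> carrier_mat (n + m) (n + m)"
    using X Y by (auto simp: M_def N_def)
  have "M * N = four_block_mat (1\<^sub>m n) (0\<^sub>m n m) Y (1\<^sub>m m + Y * X)"
    unfolding M_def N_def using X Y
    by (subst mult_four_block_mat[of _ n n _ m _ m _ _ n _ m])
       (auto intro!: arg_cong4[of _ _ _ _ _ _ _ _ four_block_mat]
         simp: comm_add_mat[of _ m m] uminus_l_inv_mat[of _ n m] comm_add_mat[of _ n m])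
  moreover have "N * M = four_block_mat (1\<^sub>m n + X * Y) (0\<^sub>m n m) Y (1\<^sub>m m)"
    unfolding M_def N_def using X Y
    by (subst mult_four_block_mat[of _ n n _ m _ m _ _ n _ m])
       (auto intro!: arg_cong4[of _ _ _ _ _ _ _ _ four_block_mat])
  moreover have "det (M * N) = det (N * M)"
    by (simp add: det_mult[OF MN] det_mult[OF MN(2,1)])
  ultimately show ?thesis using X Y
    by (simp add: det_four_block_mat_upper_right_zero[of _ n _ m])
qed

lemma det_2_mat:
  fixes M :: "'a :: comm_ring_1 mat"
  assumes "M \<in> carrier_mat 2 2"
  shows "det M = M $$ (0,0) * M $$ (1,1) - M $$ (0,1) * M $$ (1,0)"
proof -
  have "det M = (\<Sum>i<2. M $$ (i,0) * cofactor M i 0)"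
    by (rule laplace_expansion_column[OF assms]) simp
  thus ?thesis using assms
    by (simp add: eval_nat_numeral cofactor_def mat_delete_def det_single)
qed

lemma det_rank_two_update:
  fixes D D' :: "'a :: idom mat"
  assumes D: "D \<in> carrier_mat n n" and D': "D' \<in> carrier_mat n n" and inv: "D * D' = 1\<^sub>m n"
    and uvwz: "u \<in> carrier_vec n" "v \<in> carrier_vec n" "w \<in> carrier_vec n" "z \<in> carrier_vec n"
  shows "det (D + mat n n (\<lambda>(i, j). u $ i * v $ j + w $ i * z $ j)) =
         det D * ((1 + v \<bullet> (D' *\<^sub>v u)) * (1 + z \<bullet> (D' *\<^sub>v w)) - (v \<bullet> (D' *\<^sub>v w)) * (z \<bullet> (D' *\<^sub>v u)))"
proof -
  define U where "U = mat_of_cols n [u, w]"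
  define V where "V = mat_of_rows n [v, z]"
  have U: "U \<in> carrier_mat n 2" and V: "V \<in> carrier_mat 2 n"
    by (auto simp: U_def V_def numeral_2_eq_2)
  have UV: "mat n n (\<lambda>(i, j). u $ i * v $ j + w $ i * z $ j) = U * V"
    using uvwz by (intro eq_matI)
      (auto simp: U_def V_def scalar_prod_def mat_of_cols_index mat_of_rows_index)
  \<comment> \<open>Inserting \<open>D * D' = 1\<close> lets \<open>D\<close> be pulled out of the
    sum, leaving the form \<open>1 + X * Y\<close> with \<open>X = D' * U\<close> and
    \<open>Y = V\<close>.\<close>
  have "U * V = (D * D') * (U * V)"
    using U V by (simp add: inv left_mult_one_mat[OF mult_carrier_mat[OF U V]])
  also have "\<dots> = D * (D' * (U * V))"
    using D D' U V by (intro assoc_mult_mat[of _ n n _ n _ n]) auto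
  also have "D' * (U * V) = D' * U * V"
    by (rule assoc_mult_mat[OF D' U V, symmetric])
  finally have "U * V = D * (D' * U * V)" .
  hence "D + U * V = D * (1\<^sub>m n + (D' * U) * V)"
    using D D' U V by (subst mult_add_distrib_mat[of _ n n _ n]) auto
  hence "det (D + U * V) = det D * det (1\<^sub>m n + (D' * U) * V)"
    using D D' U V by (simp add: det_mult[of _ n])
  also have "det (1\<^sub>m n + (D' * U) * V) = det (1\<^sub>m 2 + V * (D' * U))"
    using D' U V by (intro det_one_plus_mult_commute) auto
  also have "\<dots> = (1 + v \<bullet> (D' *\<^sub>v u)) * (1 + z \<bullet> (D' *\<^sub>v w)) - (v \<bullet> (D' *\<^sub>v w)) * (z \<bullet> (D' *\<^sub>v u))"
    using D' U V uvwz
    by (subst det_2_mat) (auto simp: col_mult2[of _ n n _ 2] U_def V_def mult_mat_vec_def)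
  finally show ?thesis unfolding UV .
qed

subsection \<open>Eigenvalue counts and eigenvalue branches\<close>

lemma poly_det:
  fixes M :: "'a :: comm_ring_1 poly mat"
  shows "poly (det M) a = det (map_mat (\<lambda>p. poly p a) M)"
  by (rule comm_ring_hom.hom_det[symmetric]) unfold_locales

lemma poly_char_poly_0:
  assumes M: "M \<in> carrier_mat n n"
  shows "poly (char_poly M) 0 = (-1) ^ n * det M"
proof -
  have "poly (char_poly M) 0 = det (map_mat (\<lambda>p. poly p 0) (char_poly_matrix M))"
    by (simp add: char_poly_def poly_det)
  also have "map_mat (\<lambda>p. poly p 0) (char_poly_matrix M) = (-1) \<cdot>\<^sub>m M"
    using M by (intro eq_matI) (auto simp: char_poly_matrix_def)
  finally show ?thesis using M by simp
qed

lemma sgn_det_num_pos_eigenvalues: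
  assumes M: "M \<in> carrier_mat n n" and "det M \<noteq> 0"
  shows "sgn (det M) = (-1) ^ (n + num_pos_eigenvalues M)"
proof -
  have "sgn (poly (char_poly M) 0) = (-1) ^ num_pos_eigenvalues M"
    using sgn_poly_0_pos_roots[of "char_poly M"] degree_monic_char_poly[OF M] assms
    by (simp add: poly_char_poly_0[OF M] num_pos_eigenvalues_def eigenvalue_root_char_poly[OF M])
  hence "(-1) ^ n * sgn (det M) = (-1) ^ num_pos_eigenvalues M"
    by (cases "even n") (simp_all add: poly_char_poly_0[OF M] sgn_mult)
  thus ?thesis by (cases "even n") (simp_all add: power_add minus_equation_iff[of "sgn _"])
qed

text \<open>Write the characteristic polynomial as \<open>x * r\<close>. Then \<open>r\<close> is
  monic, \<open>r(0)\<close> is the linear coefficient, and the factor \<open>x\<close> does not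
  affect orders in the open right half-plane.\<close>

lemma sgn_coeff_1_char_poly:
  assumes M: "M \<in> carrier_mat n n" and "det M = 0" and c1: "coeff (char_poly M) 1 \<noteq> 0"
  shows "sgn (coeff (char_poly M) 1) = (-1) ^ num_rhp_eigenvalues M"
proof -
  let ?c = "map_poly complex_of_real"
  have "poly (char_poly M) 0 = 0" using assms by (simp add: poly_char_poly_0[OF M])
  then obtain r where r: "char_poly M = [:0, 1:] * r"
    by (auto simp: poly_eq_0_iff_dvd)
  have r0: "poly r 0 = coeff (char_poly M) 1" by (simp add: r poly_0_coeff_0)
  have "r \<noteq> 0" using r0 c1 by auto
  have lead: "lead_coeff r > 0"
    using degree_monic_char_poly[OF M] lead_coeff_mult[of "[:0,1:]" r] by (simp add: r)
  interpret h: map_poly_inj_idom_divide_hom complex_of_real by unfold_locales auto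
  have cr: "char_poly (map_mat complex_of_real M) = [:0, 1:] * ?c r"
    by (simp add: of_real_hom.char_poly_hom[OF M] r Polynomial.map_poly_pCons)
  have MC: "map_mat complex_of_real M \<in> carrier_mat n n" using M by simp
  have ord: "order x (char_poly (map_mat complex_of_real M)) = order x (?c r)" if "Re x > 0" for x
  proof -
    have "order x [:0, 1:] = 0" using that by (intro order_0I) auto
    thus ?thesis unfolding cr using \<open>r \<noteq> 0\<close> by (subst order_mult) auto
  qed
  have "num_rhp_eigenvalues M = (\<Sum>x | poly (?c r) x = 0 \<and> Re x > 0. order x (?c r))"
    unfolding num_rhp_eigenvalues_def Let_def eigenvalue_root_char_poly[OF MC]
  proof (rule sum.cong)
    show "{x. poly (char_poly (map_mat complex_of_real M)) x = 0 \<and> Re x > 0} =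
      {x. poly (?c r) x = 0 \<and> Re x > 0}" by (auto simp: cr)
  qed (simp add: ord)
  with sgn_poly_0_rhp_roots[of r] lead c1 r0 show ?thesis by simp
qed

text \<open>Implicit differentiation: the characteristic polynomial of \<open>M\<close> is a
  polynomial in \<open>x\<close> whose coefficients \<open>c k\<close> are polynomials in
  \<open>s\<close>, and it vanishes along the branch.\<close>

lemma eigenvalue_branch_derivative:
  fixes M :: "real poly mat" and s\<^sub>0 :: real
  assumes M: "M \<in> carrier_mat n n" and "open I" "s\<^sub>0 \<in> I"
    and ev: "\<And>s. s \<in> I \<Longrightarrow> eigenvalue (map_mat (\<lambda>p. poly p s) M) (ev s)"
    and ev0: "ev s\<^sub>0 = 0" and deriv: "(ev has_real_derivative d) (at s\<^sub>0)"
  shows "coeff (char_poly (map_mat (\<lambda>p. poly p s\<^sub>0) M)) 1 * d = - ((-1) ^ n * poly (pderiv (det M)) s\<^sub>0)"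
proof -
  define c where "c k = coeff (char_poly M) k" for k
  \<comment> \<open>The successor ensures that the indices 0 and 1 are both in range, even when
    \<open>n = 0\<close>.\<close>
  define N where "N = Suc (degree (char_poly M))"
  have char: "char_poly (map_mat (\<lambda>p. poly p s) M) = map_poly (\<lambda>p. poly p s) (char_poly M)" for s
    by (rule poly_hom.char_poly_hom[OF M])
  have eval: "poly (char_poly (map_mat (\<lambda>p. poly p s) M)) x = (\<Sum>k\<le>N. poly (c k) s * x ^ k)" for s x
  proof -
    let ?q = "map_poly (\<lambda>p. poly p s) (char_poly M)"
    have "degree ?q \<le> N" unfolding N_def by (rule le_SucI[OF degree_map_poly_le])
    hence "poly ?q x = (\<Sum>k\<le>N. coeff ?q k * x ^ k)"
      by (subst poly_as_sum_of_monoms'[symmetric]) (auto simp: poly_sum poly_monom)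
    thus ?thesis by (simp add: char coeff_map_poly c_def)
  qed
  define F where "F s = (\<Sum>k\<le>N. poly (c k) s * ev s ^ k)" for s
  have F0: "F s = 0" if "s \<in> I" for s
    using ev[OF that] M unfolding F_def
    by (subst (asm) eigenvalue_root_char_poly[of _ n]) (auto simp: eval)
  have "(F has_real_derivative (\<Sum>k\<le>N. poly (pderiv (c k)) s\<^sub>0 * ev s\<^sub>0 ^ k +
      poly (c k) s\<^sub>0 * (of_nat k * (d * ev s\<^sub>0 ^ (k - 1))))) (at s\<^sub>0)"
    unfolding F_def by (auto intro!: derivative_eq_intros deriv poly_DERIV simp: mult_ac)
  moreover have "(F has_real_derivative 0) (at s\<^sub>0)"
    by (rule has_field_derivative_transform_within_open[OF DERIV_const[of 0] \<open>open I\<close> \<open>s\<^sub>0 \<in> I\<close>])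
      (simp add: F0)
  ultimately have "0 = (\<Sum>k\<le>N. poly (pderiv (c k)) s\<^sub>0 * ev s\<^sub>0 ^ k +
      poly (c k) s\<^sub>0 * (of_nat k * (d * ev s\<^sub>0 ^ (k - 1))))"
    by (rule DERIV_unique[rotated])
  \<comment> \<open>For \<open>k\<close> at least 2 both \<open>ev s\<^sub>0 ^ k\<close> and
    \<open>ev s\<^sub>0 ^ (k - 1)\<close> are powers of 0 with positive exponent.\<close>
  also have "\<dots> = (\<Sum>k\<in>{0,1}. poly (pderiv (c k)) s\<^sub>0 * ev s\<^sub>0 ^ k +
      poly (c k) s\<^sub>0 * (of_nat k * (d * ev s\<^sub>0 ^ (k - 1))))"
    by (rule sum.mono_neutral_right) (auto simp: ev0 N_def power_0_left split: if_splits)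
  also have "\<dots> = poly (pderiv (c 0)) s\<^sub>0 + poly (c 1) s\<^sub>0 * d" by (simp add: ev0)
  finally have "poly (c 1) s\<^sub>0 * d = - poly (pderiv (c 0)) s\<^sub>0" by simp
  \<comment> \<open>Here \<open>poly_char_poly_0\<close> is applied over the ring of polynomials in
    \<open>s\<close>.\<close>
  moreover have "c 0 = Polynomial.smult ((-1) ^ n) (det M)"
    using poly_char_poly_0[OF M] by (cases "even n") (auto simp: c_def poly_0_coeff_0)
  moreover have "poly (c 1) s\<^sub>0 = coeff (char_poly (map_mat (\<lambda>p. poly p s\<^sub>0) M)) 1"
    by (simp add: char coeff_map_poly c_def)
  ultimately show ?thesis by (simp add: pderiv_smult)
qed

subsection \<open>The Kuramoto--Sakaguchi pencil\<close>

text \<open>The matrix itself is named, not only its determinant, because the branch lemma also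
  needs its characteristic polynomial.\<close>

definition ks_pencil :: "real vec \<Rightarrow> real \<Rightarrow> real poly mat" where
  "ks_pencil \<theta> \<alpha> = map_mat (\<lambda>c. [:c:]) (ks_D \<theta> \<alpha>) + [:0, 1:] \<cdot>\<^sub>m map_mat (\<lambda>c. [:c:]) (ks_A \<theta> \<alpha>)"

lemma ks_carrier:
  assumes "\<theta> \<in> carrier_vec n"
  shows "ks_D \<theta> \<alpha> \<in> carrier_mat n n" "ks_A \<theta> \<alpha> \<in> carrier_mat n n" "ks_pencil \<theta> \<alpha> \<in> carrier_mat n n"
    "ks_u \<theta> \<alpha> \<in> carrier_vec n" "ks_v \<theta> \<alpha> \<in> carrier_vec n" "ks_w \<theta> \<alpha> \<in> carrier_vec n" "ks_z \<theta> \<alpha> \<in> carrier_vec n"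
  using assms
  by (auto simp: ks_D_def ks_A_def ks_pencil_def ks_u_def ks_v_def ks_w_def ks_z_def mat_diag_def)

lemma ks_pencil_det_eq_det: "ks_pencil_det \<theta> \<alpha> = det (ks_pencil \<theta> \<alpha>)"
  by (simp add: ks_pencil_det_def ks_pencil_def)

lemma eval_ks_pencil:
  "map_mat (\<lambda>p. poly p s) (ks_pencil \<theta> \<alpha>) = ks_D \<theta> \<alpha> + s \<cdot>\<^sub>m ks_A \<theta> \<alpha>"
  by (intro eq_matI) (auto simp: ks_pencil_def ks_D_def ks_A_def mat_diag_def)

text \<open>Two real polynomials agree if they agree at every \<open>s\<close>; there
  \<open>s A\<close> is a rank-two matrix, with the scalar absorbed into \<open>u\<close> and
  \<open>w\<close>.\<close>

lemma ks_pencil_det_eq: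
  assumes \<theta>: "\<theta> \<in> carrier_vec n" and inv: "invertible_mat (ks_D \<theta> \<alpha>)"
  shows "ks_pencil_det \<theta> \<alpha> = Polynomial.smult (det (ks_D \<theta> \<alpha>)) (ks_P \<theta> \<alpha>)" and "det (ks_D \<theta> \<alpha>) \<noteq> 0"
proof -
  note carrier = ks_carrier[OF \<theta>, of \<alpha>]
  let ?D = "ks_D \<theta> \<alpha>"
  \<comment> \<open>\<open>invertible_mat\<close> only asserts that some inverse exists; passing to
    the units of the matrix ring shows that \<open>mat_inverse\<close> returns one.\<close>
  obtain B where B: "inverts_mat ?D B" "inverts_mat B ?D"
    using inv by (auto simp: invertible_mat_def)
  hence "B \<in> carrier_mat n n"
    using carrier(1) unfolding inverts_mat_def
    by (metis carrier_matD(1,2) carrier_matI index_mult_mat(2,3) index_one_mat(2,3))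
  with B carrier(1) have "?D \<in> Units (ring_mat TYPE(real) n ())"
    unfolding Units_def ring_mat_def inverts_mat_def by auto
  then obtain D' where D': "mat_inverse ?D = Some D'"
    using mat_inverse(1)[OF carrier(1), of "()"] by (cases "mat_inverse ?D") auto
  note D'_inv = mat_inverse(2)[OF carrier(1) D']
  have "det ?D * det D' = 1"
    using D'_inv det_mult[OF carrier(1), of D'] by simp
  thus "det (ks_D \<theta> \<alpha>) \<noteq> 0" by auto
  show "ks_pencil_det \<theta> \<alpha> = Polynomial.smult (det (ks_D \<theta> \<alpha>)) (ks_P \<theta> \<alpha>)"
  proof (rule poly_eq_poly_eq_iff[THEN iffD1], rule ext)
    fix s
    let ?u = "ks_u \<theta> \<alpha>" and ?v = "ks_v \<theta> \<alpha>" and ?w = "ks_w \<theta> \<alpha>" and ?z = "ks_z \<theta> \<alpha>"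
    have "s \<cdot>\<^sub>m ks_A \<theta> \<alpha> = mat n n (\<lambda>(i, j). (s \<cdot>\<^sub>v ?u) $ i * ?v $ j + (s \<cdot>\<^sub>v ?w) $ i * ?z $ j)"
    proof (rule eq_matI; clarsimp simp: ks_A_def ks_u_def ks_v_def ks_w_def ks_z_def carrier_vecD[OF \<theta>])
      fix i j
      \<comment> \<open>Splitting the phase lag evenly between the two angles makes the subtraction
        formula yield the entries of \<open>u\<close>, \<open>v\<close>, \<open>w\<close> and
        \<open>z\<close>.\<close>
      have "cos (\<theta> $ j - \<theta> $ i - \<alpha>) = cos ((\<theta> $ i + \<alpha> / 2) - (\<theta> $ j - \<alpha> / 2))"
        by (subst cos_minus[symmetric]) (simp add: algebra_simps)
      thus "s * cos (\<theta> $ j - \<theta> $ i - \<alpha>) =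
        s * cos (\<theta> $ i + \<alpha> / 2) * cos (\<theta> $ j - \<alpha> / 2) + s * sin (\<theta> $ i + \<alpha> / 2) * sin (\<theta> $ j - \<alpha> / 2)"
        by (simp only: cos_diff) (simp add: algebra_simps)
    qed
    moreover have "poly (ks_pencil_det \<theta> \<alpha>) s = det (?D + s \<cdot>\<^sub>m ks_A \<theta> \<alpha>)"
      by (simp add: ks_pencil_det_eq_det poly_det eval_ks_pencil)
    ultimately have "poly (ks_pencil_det \<theta> \<alpha>) s = det ?D *
      ((1 + ?v \<bullet> (D' *\<^sub>v (s \<cdot>\<^sub>v ?u))) * (1 + ?z \<bullet> (D' *\<^sub>v (s \<cdot>\<^sub>v ?w))) -
       (?v \<bullet> (D' *\<^sub>v (s \<cdot>\<^sub>v ?w))) * (?z \<bullet> (D' *\<^sub>v (s \<cdot>\<^sub>v ?u))))"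
      using D'_inv carrier by (simp add: det_rank_two_update)
    also have "\<dots> = poly (Polynomial.smult (det ?D) (ks_P \<theta> \<alpha>)) s"
      using D'_inv carrier
      by (simp add: ks_P_def D' Let_def mult_mat_vec[of _ n n] mult_mat_vec_carrier[of _ n n]
        scalar_prod_smult_distrib[where n = n])
        (simp add: algebra_simps)
    finally show "poly (ks_pencil_det \<theta> \<alpha>) s = poly (Polynomial.smult (det ?D) (ks_P \<theta> \<alpha>)) s" .
  qed
qed

text \<open>Since \<open>P\<close> has degree at most two, \<open>P(0) = 1\<close> and \<open>P(1) = 0\<close>, it factors as
  \<open>(1 - s) (1 + c s)\<close>, and everything is read off from \<open>c\<close>.\<close>

lemma sgn_pderiv_quadratic:
  fixes b a :: real
  defines "P \<equiv> [:1, b, a:]"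
  assumes "poly P 1 = 0" and "poly (pderiv P) 1 \<noteq> 0"
  shows "sgn (poly (pderiv P) 1) = - ((-1) ^ card {s. 0 < s \<and> s < 1 \<and> poly P s = 0})"
proof -
  define c where "c = 1 + b"
  have a: "a = - c" and b: "b = c - 1" using assms by (auto simp: P_def c_def)
  have factor: "poly P s = (1 - s) * (1 + c * s)" for s
    by (simp add: P_def a b algebra_simps)
  have pd: "poly (pderiv P) 1 = - (1 + c)" by (simp add: P_def a b pderiv_pCons)
  show ?thesis
  \<comment> \<open>The other root is \<open>-1 / c\<close>, which lies in (0, 1) exactly when
    \<open>c < -1\<close>, and the derivative at 1 is \<open>-(1 + c)\<close>.\<close>
  proof (cases "c < -1")
    case True
    hence "- c / c = -1" by (simp add: divide_eq_eq)
    with True have "{s. 0 < s \<and> s < 1 \<and> poly P s = 0} = {- 1 / c}"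
      by (auto simp: factor minus_divide_left nonzero_eq_divide_eq divide_less_eq less_divide_eq mult.commute
          add_eq_0_iff2 simp del: divide_minus_left minus_divide_left[symmetric])
    with True show ?thesis by (simp add: pd)
  next
    case False
    have "1 + c * s > 0" if "0 < s" "s < 1" for s
    proof -
      \<comment> \<open>This gives \<open>1 + c * s\<close> at least \<open>1 - s\<close>, which is
        positive. The boundary value \<open>c = -1\<close>, a double root at 1, is ruled out only
        later by the derivative hypothesis.\<close>
      have "- 1 * s \<le> c * s" using False that by (intro mult_right_mono) auto
      with that show ?thesis by simp
    qed
    hence no_roots: "{s. 0 < s \<and> s < 1 \<and> poly P s = 0} = {}"
      by (fastforce simp: factor)
    show ?thesis unfolding no_roots using False assms(3) by (simp add: pd)
  qed
qed

lemma simple_root_if_order_1: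
  fixes p :: "'a :: field_char_0 poly"
  assumes "order x p = 1" "p \<noteq> 0"
  shows "poly p x = 0" "poly (pderiv p) x \<noteq> 0"
proof -
  show root: "poly p x = 0" using assms by (simp add: order_root)
  have "pderiv p \<noteq> 0"
  proof
    assume "pderiv p = 0"
    then obtain c where "p = [:c:]" by (auto simp: pderiv_eq_0_iff elim: degree_eq_zeroE)
    with root \<open>p \<noteq> 0\<close> show False by simp
  qed
  moreover have "order x (pderiv p) = 0"
    using order_pderiv[OF \<open>p \<noteq> 0\<close> root] assms by simp
  ultimately show "poly (pderiv p) x \<noteq> 0" by (simp add: order_root)
qed

theorem theorem2p7:
  fixes n :: nat and \<alpha> :: real and \<theta> :: "real vec"
    and D A :: "real mat" and nD nR nDA :: nat
    and I :: "real set" and ev0 :: "real \<Rightarrow> real" and dev0 :: real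
  assumes "n \<ge> 1" and "\<bar>\<alpha>\<bar> < pi / 2" and "\<theta> \<in> carrier_vec n"
    and D_def: "D = ks_D \<theta> \<alpha>" and A_def: "A = ks_A \<theta> \<alpha>"
    and "invertible_mat D"
    and nD_def: "nD = num_pos_eigenvalues D"
    and nR_def: "nR = card {s. 0 < s \<and> s < 1 \<and> poly (ks_P \<theta> \<alpha>) s = 0}"
    and nDA_def: "nDA = num_rhp_eigenvalues (D + A)"
    and simple_root: "order 1 (ks_pencil_det \<theta> \<alpha>) = 1"
    and "open I" and "1 \<in> I"
    and branch: "\<And>s. s \<in> I \<Longrightarrow> eigenvalue (D + s \<cdot>\<^sub>m A) (ev0 s)"
    and branch_differentiable: "\<And>s. s \<in> I \<Longrightarrow> ev0 differentiable (at s)"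
    and "ev0 1 = 0"
    and derivative: "(ev0 has_real_derivative dev0) (at 1)"
  shows "(- 1 :: real) powi (int nDA - int nD - int nR) = sgn dev0
       \<and> (nR = 0 \<and> even nD \<and> dev0 < 0 \<longrightarrow> nDA \<ge> 1)
       \<and> (nR = 0 \<and> odd nD \<and> dev0 > 0 \<longrightarrow> nDA \<ge> 1)
       \<and> (nR = 1 \<and> even nD \<and> dev0 > 0 \<longrightarrow> nDA \<ge> 1)
       \<and> (nR = 1 \<and> odd nD \<and> dev0 < 0 \<longrightarrow> nDA \<ge> 1)"
proof -
  note carrier = ks_carrier[OF \<open>\<theta> \<in> carrier_vec n\<close>, of \<alpha>]
  note pencil = ks_pencil_det_eq[OF \<open>\<theta> \<in> carrier_vec n\<close> \<open>invertible_mat D\<close>[unfolded D_def]]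
  have at_1: "D + 1 \<cdot>\<^sub>m A = D + A" by (auto simp: A_def)
  have DA: "D + A \<in> carrier_mat n n" using carrier by (simp add: D_def A_def)
  have "ks_pencil_det \<theta> \<alpha> \<noteq> 0" using pencil by (auto simp: ks_P_def Let_def)
  note root = simple_root_if_order_1[OF simple_root this]
  have P: "poly (ks_P \<theta> \<alpha>) 1 = 0" "poly (pderiv (ks_P \<theta> \<alpha>)) 1 \<noteq> 0"
    using root pencil by (auto simp: pderiv_smult)
  have "sgn (poly (pderiv (ks_P \<theta> \<alpha>)) 1) = - ((-1) ^ nR)"
    using P unfolding nR_def ks_P_def Let_def by (rule sgn_pderiv_quadratic)
  \<comment> \<open>The factor \<open>det D\<close> contributes the parity of \<open>n + nD\<close>,
    the derivative of the quadratic that of \<open>nR\<close>.\<close>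
  hence sgn_pderiv: "sgn (poly (pderiv (ks_pencil_det \<theta> \<alpha>)) 1) = - ((-1) ^ (n + nD + nR))"
    using sgn_det_num_pos_eigenvalues[OF carrier(1) pencil(2)]
    by (simp add: pencil(1) pderiv_smult sgn_mult nD_def D_def power_add)
  have det_DA: "det (D + A) = 0"
    using root(1) at_1 by (simp add: ks_pencil_det_eq_det poly_det eval_ks_pencil D_def A_def)
  have "coeff (char_poly (D + A)) 1 * dev0 = - ((-1) ^ n * poly (pderiv (ks_pencil_det \<theta> \<alpha>)) 1)"
    using eigenvalue_branch_derivative[OF carrier(3) \<open>open I\<close> \<open>1 \<in> I\<close> _ \<open>ev0 1 = 0\<close> derivative]
      branch at_1
    by (simp add: eval_ks_pencil ks_pencil_det_eq_det D_def A_def)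
  moreover from this have c1: "coeff (char_poly (D + A)) 1 \<noteq> 0" using root by auto
  ultimately have "sgn (coeff (char_poly (D + A)) 1) * sgn dev0 =
      - ((-1) ^ n * sgn (poly (pderiv (ks_pencil_det \<theta> \<alpha>)) 1))"
    by (simp add: sgn_mult flip: sgn_mult[of "coeff _ _"])
  \<comment> \<open>The two minus signs cancel, and so do the two factors
    \<open>(-1) ^ n\<close>.\<close>
  hence "(-1) ^ nDA * sgn dev0 = (-1) ^ (nD + nR)"
    using sgn_coeff_1_char_poly[OF DA det_DA c1] sgn_pderiv
    by (simp add: nDA_def power_add)
  hence sgn_dev0: "sgn dev0 = (-1) ^ (nDA + nD + nR)"
    by (auto simp: uminus_power_if split: if_splits)
  \<comment> \<open>The integer exponent may be negative, but only its parity matters.\<close>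
  moreover have "(- 1 :: real) powi (int nDA - int nD - int nR) = (-1) ^ (nDA + nD + nR)"
    by (auto simp: power_int_minus_left uminus_power_if)
  \<comment> \<open>In each of the four cases the sign of \<open>dev0\<close> forces
    \<open>nDA\<close> to be odd, hence nonzero.\<close>
  moreover have "nDA \<ge> 1" if "odd nDA" using that by (cases nDA) auto
  ultimately show ?thesis by (auto simp: uminus_power_if split: if_splits)
qed

end
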